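(* Consider a chores Fisher market with $n$ agents and $m$ divisible chores, disutilities $d_{ij}>0$ and earning requirements $B_i>0$. Consider the two programs $$\text{(P)}\quad \inf_{x\ge0,\;u\ge0}\ f^p(x,u):=\sum_i B_i\log(u_i)\quad\text{s.t.}\quad \langle d_i,x_i\rangle\le u_i\ \ \forall i\in[n],\qquad -\sum_i x_{ij}\le-1\ \ \forall j\in[m],$$ with multipliers $\beta_i$ (first constraints) and $p_j$ (second constraints), and $$\text{(D)}\quad \sup_{\beta\ge0,\;p\ge0}\ f^d(\beta,p):=\sum_j p_j-\sum_i B_i\log\beta_i+\sum_i\big(B_i\log B_i-B_i\big)\quad\text{s.t.}\quad p_j\le d_{ij}\beta_i\ \ \forall i\in[n],\,j\in[m],$$ with multipliers $x_{ij}$. Then: 1. If $(x,u,\beta,p)$ is a KKT point of (P), then $(\beta,p,x)$ is a KKT point of (D). 2. Conversely, if $(\beta,p,x)$ is a KKT point of (D) and $u_i=\langle d_i,x_i\rangle$ for all $i\in[n]$, then $(x,u,\beta,p)$ is a KKT point of (P). 3. If $(x,u,\beta,p)$ is a KKT point of (P), then $f^p(x,u)=f^d(\beta,p)$.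
   Context: Notation: $[k]=\{1,\dots,k\}$, $n,m\ge1$, $d_i=(d_{i1},\dots,d_{im})$, $x_i=(x_{i1},\dots,x_{im})$, and $\langle\cdot,\cdot\rangle$ is the Euclidean inner product. A KKT point is a tuple of primal variables and multipliers satisfying the KKT conditions of the program; the domain of the logarithm forces $u>0$ in (P) and $\beta>0$ in (D). Explicitly, $(x,u,\beta,p)$ is a KKT point of (P) if: $x\ge0$, $u>0$, $\beta\ge0$, $p\ge0$; $\langle d_i,x_i\rangle\le u_i$ and $\beta_i(u_i-\langle d_i,x_i\rangle)=0$ for all $i$; $\sum_i x_{ij}\ge1$ and $p_j(\sum_i x_{ij}-1)=0$ for all $j$; $\beta_i=B_i/u_i$ for all $i$; $d_{ij}\beta_i-p_j\ge0$ and $x_{ij}(d_{ij}\beta_i-p_j)=0$ for all $i,j$. Explicitly, $(\beta,p,x)$ is a KKT point of (D) if: $p\ge0$, $x\ge0$, $\beta>0$; $d_{ij}\beta_i\ge p_j$ and $x_{ij}(d_{ij}\beta_i-p_j)=0$ for all $i,j$; $\sum_i x_{ij}\ge1$ and $p_j(\sum_i x_{ij}-1)=0$ for all $j$; $\sum_j d_{ij}x_{ij}\ge B_i/\beta_i$ and $\beta_i\left(\sum_j d_{ij}x_{ij}-B_i/\beta_i\right)=0$ for all $i$. *)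

theory Defs
  imports "HOL-Analysis.Analysis"
begin

text \<open>
  Agents are the elements of the finite type 'n and chores those of the finite type 'm; both types
  are nonempty, so there are at least one agent and one chore.  The row \<open>x $ i\<close> is the bundle of
  agent i, and \<open>x $ i $ j\<close> is the amount of chore j that agent i does.
\<close>

definition primal_objective :: "real^'n \<Rightarrow> real^'m^'n \<Rightarrow> real^'n \<Rightarrow> real" where
  "primal_objective B x u = (\<Sum>i\<in>UNIV. B $ i * ln (u $ i))"

text \<open>
  The programs state \<open>u \<ge> 0\<close> and \<open>\<beta> \<ge> 0\<close>, and the domain of the logarithm in the objectives excludes
  the value 0.  As \<open>ln\<close> is a total function on the reals here, the feasibility predicates require
  \<open>u > 0\<close> and \<open>\<beta> > 0\<close> explicitly.
\<close>

definition primal_feasible :: "real^'m^'n \<Rightarrow> real^'m^'n \<Rightarrow> real^'n \<Rightarrow> bool" where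
  "primal_feasible d x u \<longleftrightarrow>
     (\<forall>i j. x $ i $ j \<ge> 0) \<and>
     (\<forall>i. u $ i > 0) \<and>
     (\<forall>i. d $ i \<bullet> x $ i \<le> u $ i) \<and>
     (\<forall>j. (\<Sum>i\<in>UNIV. x $ i $ j) \<ge> 1)"

definition dual_objective :: "real^'n \<Rightarrow> real^'n \<Rightarrow> real^'m \<Rightarrow> real" where
  "dual_objective B \<beta> p =
     (\<Sum>j\<in>UNIV. p $ j) - (\<Sum>i\<in>UNIV. B $ i * ln (\<beta> $ i))
       + (\<Sum>i\<in>UNIV. B $ i * ln (B $ i) - B $ i)"

definition dual_feasible :: "real^'m^'n \<Rightarrow> real^'n \<Rightarrow> real^'m \<Rightarrow> bool" where
  "dual_feasible d \<beta> p \<longleftrightarrow>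
     (\<forall>i. \<beta> $ i > 0) \<and>
     (\<forall>j. p $ j \<ge> 0) \<and>
     (\<forall>i j. p $ j \<le> d $ i $ j * \<beta> $ i)"

text \<open>
  In both KKT systems the multipliers of the sign constraints are eliminated.  For \<open>x \<ge> 0\<close> in the
  primal and for \<open>p \<ge> 0\<close> and \<open>\<beta> \<ge> 0\<close> in the dual, the multiplier appears as the reduced gradient: an
  inequality together with complementary slackness.  As \<open>u > 0\<close>, the multiplier of \<open>u \<ge> 0\<close> vanishes,
  and stationarity in u is the equation \<open>\<beta> $ i = B $ i / u $ i\<close>.
\<close>

definition primal_KKT ::
  "real^'m^'n \<Rightarrow> real^'n \<Rightarrow> real^'m^'n \<Rightarrow> real^'n \<Rightarrow> real^'n \<Rightarrow> real^'m \<Rightarrow> bool" where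
  "primal_KKT d B x u \<beta> p \<longleftrightarrow>
     primal_feasible d x u \<and>
     (\<forall>i. \<beta> $ i \<ge> 0) \<and> (\<forall>j. p $ j \<ge> 0) \<and>
     (\<forall>i. \<beta> $ i * (u $ i - d $ i \<bullet> x $ i) = 0) \<and>
     (\<forall>j. p $ j * ((\<Sum>i\<in>UNIV. x $ i $ j) - 1) = 0) \<and>
     (\<forall>i. \<beta> $ i = B $ i / u $ i) \<and>
     (\<forall>i j. d $ i $ j * \<beta> $ i - p $ j \<ge> 0 \<and> x $ i $ j * (d $ i $ j * \<beta> $ i - p $ j) = 0)"

definition dual_KKT ::
  "real^'m^'n \<Rightarrow> real^'n \<Rightarrow> real^'n \<Rightarrow> real^'m \<Rightarrow> real^'m^'n \<Rightarrow> bool" where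
  "dual_KKT d B \<beta> p x \<longleftrightarrow>
     dual_feasible d \<beta> p \<and>
     (\<forall>i j. x $ i $ j \<ge> 0) \<and>
     (\<forall>i j. x $ i $ j * (d $ i $ j * \<beta> $ i - p $ j) = 0) \<and>
     (\<forall>j. (\<Sum>i\<in>UNIV. x $ i $ j) \<ge> 1 \<and> p $ j * ((\<Sum>i\<in>UNIV. x $ i $ j) - 1) = 0) \<and>
     (\<forall>i. (\<Sum>j\<in>UNIV. d $ i $ j * x $ i $ j) \<ge> B $ i / \<beta> $ i \<and>
          \<beta> $ i * ((\<Sum>j\<in>UNIV. d $ i $ j * x $ i $ j) - B $ i / \<beta> $ i) = 0)"

end

theory Submission
  imports Defs
begin

text \<open>Stationarity in \<open>u\<close> together with \<open>B $ i > 0\<close> makes \<beta>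
  strictly positive, so complementary slackness forces the disutility constraint of agent i to be
  tight.\<close>

lemma primal_KKT_multiplier:
  assumes "primal_KKT d B x u \<beta> p" and "B $ i > 0"
  shows "u $ i > 0" and "\<beta> $ i = B $ i / u $ i" and "\<beta> $ i > 0" and "d $ i \<bullet> x $ i = u $ i"
proof -
  show u: "u $ i > 0" and \<beta>: "\<beta> $ i = B $ i / u $ i"
    using assms(1) by (auto simp: primal_KKT_def primal_feasible_def)
  show pos: "\<beta> $ i > 0"
    using u \<beta> assms(2) by simp
  have "\<beta> $ i * (u $ i - d $ i \<bullet> x $ i) = 0"
    using assms(1) unfolding primal_KKT_def by blast
  with pos show "d $ i \<bullet> x $ i = u $ i"
    by simp
qed

lemma inner_eq_sum_components:
  fixes v w :: "real^'m"
  shows "v \<bullet> w = (\<Sum>j\<in>UNIV. v $ j * w $ j)"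
  by (simp add: inner_vec_def)

lemma primal_KKT_imp_dual_KKT:
  assumes "primal_KKT d B x u \<beta> p" and "\<And>i. B $ i > 0"
  shows "dual_KKT d B \<beta> p x"
proof -
  \<comment> \<open>Both sides equal \<open>u $ i\<close>: the left by tightness, the right by
    inverting stationarity. Rewriting with this equation trivializes the earning condition and its
    slackness in the dual system.\<close>
  have income: "(\<Sum>j\<in>UNIV. d $ i $ j * x $ i $ j) = B $ i / \<beta> $ i" for i
    using primal_KKT_multiplier[OF assms(1) assms(2), of i] assms(2)[of i]
    by (simp add: inner_eq_sum_components)
  have "\<beta> $ i > 0" for i
    using primal_KKT_multiplier(3)[OF assms(1) assms(2)] .
  then show ?thesis
    using assms(1)
    unfolding primal_KKT_def primal_feasible_def dual_KKT_def dual_feasible_def diff_ge_0_iff_ge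
      income diff_self mult_zero_right
    by blast
qed

text \<open>Cancelling \<beta> > 0 in the slackness of the earning condition gives
  \<open>u $ i = B $ i / \<beta> $ i\<close>. This yields both \<open>u $ i > 0\<close> and,
  inverted, stationarity in \<open>u\<close>; primal slackness is immediate from the choice of
  \<open>u\<close>.\<close>

lemma dual_KKT_imp_primal_KKT:
  assumes "dual_KKT d B \<beta> p x" and "\<And>i. u $ i = d $ i \<bullet> x $ i" and "\<And>i. B $ i > 0"
  shows "primal_KKT d B x u \<beta> p"
proof -
  have \<beta>: "\<beta> $ i > 0" for i
    using assms(1) by (simp add: dual_KKT_def dual_feasible_def)
  have u: "u $ i = B $ i / \<beta> $ i" for i
  proof -
    have "\<beta> $ i * (u $ i - B $ i / \<beta> $ i) = 0"
      using assms(1) by (simp add: dual_KKT_def assms(2) inner_eq_sum_components)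
    with \<beta>[of i] show ?thesis
      by simp
  qed
  have "u $ i > 0" and "\<beta> $ i = B $ i / u $ i" for i
    using \<beta>[of i] assms(3)[of i] by (simp_all add: u)
  then show ?thesis
    using assms(1,2) \<beta>
    by (auto simp: primal_KKT_def primal_feasible_def dual_KKT_def dual_feasible_def less_imp_le)
qed

text \<open>
  Complementary slackness turns the total price into the total disutility weighted by \<open>\<beta>\<close>, and
  agent i contributes \<open>\<beta> $ i * u $ i = B $ i\<close> to it.
\<close>

lemma primal_KKT_sum_prices:
  assumes "primal_KKT d B x u \<beta> p" and "\<And>i. B $ i > 0"
  shows "(\<Sum>j\<in>UNIV. p $ j) = (\<Sum>i\<in>UNIV. B $ i)"
proof -
  \<comment> \<open>A chore assigned in total more than once has price 0, so the identity survives
    over-assignment.\<close>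
  have "p $ j = (\<Sum>i\<in>UNIV. x $ i $ j * p $ j)" for j
  proof -
    have "p $ j * ((\<Sum>i\<in>UNIV. x $ i $ j) - 1) = 0"
      using assms(1) by (simp add: primal_KKT_def)
    then show ?thesis
      by (auto simp: sum_distrib_right[symmetric])
  qed
  then have "(\<Sum>j\<in>UNIV. p $ j) = (\<Sum>j\<in>UNIV. \<Sum>i\<in>UNIV. x $ i $ j * p $ j)"
    by (intro sum.cong refl)
  also have "\<dots> = (\<Sum>i\<in>UNIV. \<Sum>j\<in>UNIV. x $ i $ j * p $ j)"
    by (rule sum.swap)
  also have "\<dots> = (\<Sum>i\<in>UNIV. \<beta> $ i * (d $ i \<bullet> x $ i))"
  proof -
    have "x $ i $ j * p $ j = \<beta> $ i * (d $ i $ j * x $ i $ j)" for i j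
    proof -
      have "x $ i $ j * (d $ i $ j * \<beta> $ i - p $ j) = 0"
        using assms(1) unfolding primal_KKT_def by blast
      then show ?thesis
        by (simp only: algebra_simps)
    qed
    then show ?thesis
      unfolding inner_eq_sum_components sum_distrib_left by (intro sum.cong refl)
  qed
  also have "\<dots> = (\<Sum>i\<in>UNIV. B $ i)"
  proof (intro sum.cong refl)
    fix i
    show "\<beta> $ i * (d $ i \<bullet> x $ i) = B $ i"
      using primal_KKT_multiplier[OF assms(1) assms(2), of i] by simp
  qed
  finally show ?thesis .
qed

text \<open>Substituting \<beta> = B / u splits each dual logarithm into a \<open>u\<close> part,
  which is the primal objective, and a \<open>B\<close> part. The constant term of the dual
  objective cancels the latter, and its remaining summand -B cancels the total price.\<close>

lemma primal_KKT_objectives_eq: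
  assumes "primal_KKT d B x u \<beta> p" and "\<And>i. B $ i > 0"
  shows "primal_objective B x u = dual_objective B \<beta> p"
proof -
  have "ln (\<beta> $ i) = ln (B $ i) - ln (u $ i)" for i
    using primal_KKT_multiplier(1,2)[OF assms(1) assms(2), of i] assms(2)[of i]
    by (simp add: ln_div)
  then show ?thesis
    by (simp add: primal_objective_def dual_objective_def primal_KKT_sum_prices[OF assms]
        right_diff_distrib sum_subtractf)
qed

theorem theorem2:
  fixes d :: "real^'m^'n" and B :: "real^'n"
  assumes d_pos: "\<And>i j. d $ i $ j > 0"
    and B_pos: "\<And>i. B $ i > 0"
  shows "(\<forall>x u \<beta> p. primal_KKT d B x u \<beta> p \<longrightarrow> dual_KKT d B \<beta> p x) \<and>
    (\<forall>\<beta> p x u. dual_KKT d B \<beta> p x \<and> (\<forall>i. u $ i = d $ i \<bullet> x $ i) \<longrightarrow> primal_KKT d B x u \<beta> p) \<and>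
    (\<forall>x u \<beta> p. primal_KKT d B x u \<beta> p \<longrightarrow> primal_objective B x u = dual_objective B \<beta> p)"
  using primal_KKT_imp_dual_KKT dual_KKT_imp_primal_KKT primal_KKT_objectives_eq B_pos by blast

end
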